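(* Let $q$ be a power of an odd prime $p$, let $m\in\{1,2,3\}$, and let $e$ be an integer with $0\le e<q$. In the polynomial ring $\mathbb{Z}[\beta]$ put $\alpha=1-\beta$ and $c=\beta(1-\beta)$, and let $x=c^2/(1-c)^3$. Then $$2(2+c)(1-c)^{mq-1-e}\sum_{0\le k<(mq-e)/3}\binom{3k+e}{k}x^k\equiv(\alpha^{mq-e}+\beta^{mq-e})+3\,\frac{\alpha^{mq-e}-\beta^{mq-e}}{\alpha-\beta}-2(-c)^{mq-e}\pmod{p}.$$
   Context: Here $\beta$ is an indeterminate, $q=p^f$ with $f\ge 1$, and the sum is over integers $k$ in the indicated range. Although $x$ is a rational function, both sides of the congruence are polynomials in $\mathbb{Z}[\beta]$: on the left, $(1-c)^{mq-1-e}x^k=c^{2k}(1-c)^{mq-1-e-3k}$, with nonnegative exponent $mq-1-e-3k$ for each $k$ in the range; on the right, the quotient by $\alpha-\beta=1-2\beta$ is exact. The congruence modulo $p$ means that the difference of the two sides lies in $p\,\mathbb{Z}[\beta]$. *)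

theory Defs
  imports Complex_Main "HOL-Computational_Algebra.Computational_Algebra"
begin

(* The ring Z[beta] is int poly, with beta = [:0, 1:]; rational functions live in its fraction
   field, into which to_fract embeds it.  Elements u, v of the fraction field are congruent
   modulo p if both are polynomials and their difference lies in p Z[beta].  Since to_fract is
   injective, U and V are uniquely determined by u and v. *)
definition poly_cong :: "int \<Rightarrow> int poly fract \<Rightarrow> int poly fract \<Rightarrow> bool" where
  "poly_cong p u v \<longleftrightarrow>
     (\<exists>U V :: int poly. u = to_fract U \<and> v = to_fract V \<and> [:p:] dvd U - V)"

end

theory Submission
  imports Defs "HOL-Number_Theory.Cong"
begin

text \<open>
  Put \<open>n = mq - e\<close>. Modulo \<open>p\<close> the binomial coefficients \<open>(mq choose j)\<close> with \<open>0 < j < q\<close> vanish, so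
  \<open>(3k + e choose k) = (mq - (n - 3k) choose k)\<close> agrees with \<open>(-(n - 3k) choose k)\<close>, which is
  \<open>(-1)\<^sup>k (n - 1 - 2k choose k)\<close>. After this replacement the congruence becomes an
  identity over the integers: the left-hand sums have generating function
  \<open>1 / (1 - (1 - c) t + c\<^sup>2 t\<^sup>3)\<close>, and
  \<open>t\<^sup>3 - (1 - c) t\<^sup>2 + c\<^sup>2 = (t - \<alpha>) (t - \<beta>) (t + c)\<close>, so both sides satisfy the same
  recurrence of order three in \<open>n\<close>.
\<close>

text \<open>In \<open>j * (N choose j) = N * ((N - 1) choose (j - 1))\<close> the right side is
  divisible by \<open>p ^ f\<close>. If \<open>p\<close> did not divide \<open>N choose j\<close>,
  all of \<open>p ^ f\<close> would have to divide the smaller number \<open>j\<close>.\<close>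

lemma prime_dvd_choose_multiple:
  fixes p :: nat
  assumes p: "prime p" and dvd: "p ^ f dvd N" and j: "0 < j" "j < p ^ f"
  shows "p dvd N choose j"
proof (rule ccontr)
  assume "\<not> p dvd N choose j"
  then have cop: "coprime (p ^ f) (N choose j)"
    using p prime_imp_coprime by auto
  have "j * (N choose j) = N * ((N - 1) choose (j - 1))"
    using times_binomial_minus1_eq[OF j(1)] by simp
  then have "p ^ f dvd j * (N choose j)"
    using dvd by simp
  then have "p ^ f dvd j"
    using cop coprime_dvd_mult_left_iff by blast
  then show False
    using j by (simp add: nat_dvd_not_less)
qed

text \<open>Modulo \<open>p\<close> the number \<open>N\<close> acts like 0 here, and the right side
  is the binomial coefficient of \<open>-(s + 1)\<close> over \<open>k\<close>. Pascal's rule drives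
  both inductions; divisibility by \<open>p\<close> enters only for \<open>s = 0\<close>, through
  \<open>N choose Suc k\<close>.\<close>

lemma choose_diff_cong:
  fixes p :: nat
  assumes p: "prime p" and dvd: "p ^ f dvd N" and "Suc s \<le> N" and "k < p ^ f"
  shows "[int ((N - Suc s) choose k) = (- 1) ^ k * int ((s + k) choose k)] (mod int p)"
  using assms(3,4)
proof (induction s arbitrary: k)
  case 0
  then show ?case
  proof (induction k)
    case 0
    show ?case by simp
  next
    case (Suc k)
    have "N choose Suc k = ((N - 1) choose Suc k) + ((N - 1) choose k)"
      using Suc.prems by (cases N) auto
    moreover have "int p dvd int (N choose Suc k)"
      using prime_dvd_choose_multiple[OF p dvd] Suc.prems by simp
    ultimately have "[int ((N - 1) choose Suc k) = - int ((N - 1) choose k)] (mod int p)"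
      by (simp add: cong_iff_dvd_diff)
    also have "[- int ((N - 1) choose k) = - ((- 1) ^ k)] (mod int p)"
      using Suc by (simp add: cong_minus_minus_iff)
    finally show ?case by simp
  qed
next
  case (Suc s)
  note outer = Suc.IH and le = Suc.prems(1)
  from Suc.prems(2) show ?case
  proof (induction k)
    case 0
    show ?case by simp
  next
    case (Suc k)
    let ?a = "N - Suc (Suc s)"
    have "N - Suc s = Suc ?a"
      using le by simp
    then have "int (?a choose Suc k) = int ((N - Suc s) choose Suc k) - int (?a choose k)"
      by simp
    also have "[\<dots> = (- 1) ^ Suc k * int ((s + Suc k) choose Suc k)
        - (- 1) ^ k * int ((Suc s + k) choose k)] (mod int p)"
      using outer[of "Suc k"] Suc le by (intro cong_diff) auto
    also have "(- 1) ^ Suc k * int ((s + Suc k) choose Suc k)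
        - (- 1) ^ k * int ((Suc s + k) choose k)
        = (- 1) ^ Suc k * int ((Suc s + Suc k) choose Suc k)"
      by (simp add: algebra_simps)
    finally show ?case .
  qed
qed

text \<open>The sum for \<open>mq - e\<close> is \<open>tri_sum (1 - c) (- c\<^sup>2) (mq - e - 1)\<close>: the index is shifted by one.\<close>
definition tri_sum :: "'a::comm_ring_1 \<Rightarrow> 'a \<Rightarrow> nat \<Rightarrow> 'a" where
  "tri_sum u v n = (\<Sum>k\<le>n div 3. of_nat ((n - 2 * k) choose k) * v ^ k * u ^ (n - 3 * k))"

text \<open>Allows sums for different \<open>n\<close> to be compared over a common range: past
  \<open>n div 3\<close> the lower index exceeds the upper one, even where the subtraction truncates
  to 0.\<close>

lemma tri_sum_eq:
  assumes "n div 3 \<le> K"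
  shows "tri_sum u v n = (\<Sum>k\<le>K. of_nat ((n - 2 * k) choose k) * v ^ k * u ^ (n - 3 * k))"
  unfolding tri_sum_def
proof (rule sum.mono_neutral_left)
  show "\<forall>k\<in>{..K} - {..n div 3}.
      of_nat ((n - 2 * k) choose k) * v ^ k * u ^ (n - 3 * k) = 0"
  proof
    fix k assume "k \<in> {..K} - {..n div 3}"
    then have "n - 2 * k < k" by auto
    then show "of_nat ((n - 2 * k) choose k) * v ^ k * u ^ (n - 3 * k) = 0"
      by (simp add: binomial_eq_0)
  qed
qed (use assms in auto)

text \<open>Pascal's rule splits term \<open>Suc k\<close> for \<open>n + 3\<close> into term
  \<open>Suc k\<close> for \<open>n + 2\<close> and term \<open>k\<close> for
  \<open>n\<close>.\<close>

lemma tri_sum_rec: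
  "tri_sum u v (n + 3) = u * tri_sum u v (n + 2) + v * tri_sum u v n"
proof -
  let ?K = "n div 3"
  have step: "of_nat ((n + 3 - 2 * Suc k) choose Suc k) * v ^ Suc k * u ^ (n + 3 - 3 * Suc k)
      = u * (of_nat ((n + 2 - 2 * Suc k) choose Suc k) * v ^ Suc k * u ^ (n + 2 - 3 * Suc k))
        + v * (of_nat ((n - 2 * k) choose k) * v ^ k * u ^ (n - 3 * k))"
    if k: "k \<le> ?K" for k
  proof -
    have k3: "3 * k \<le> n" using k by linarith
    then have pascal: "(n + 3 - 2 * Suc k) choose Suc k
        = ((n - 2 * k) choose Suc k) + ((n - 2 * k) choose k)"
      by (simp add: Suc_diff_le)
    have u: "of_nat ((n - 2 * k) choose Suc k) * u ^ (n - 3 * k)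
        = u * (of_nat ((n - 2 * k) choose Suc k) * u ^ (n + 2 - 3 * Suc k))"
    \<comment> \<open>For \<open>3 * k = n\<close> the exponent on the right truncates and the
      powers of \<open>u\<close> disagree, but then the binomial coefficient is
      \<open>k choose Suc k\<close>, which is 0.\<close>
    proof (cases "3 * k = n")
      case True
      then show ?thesis by (simp add: binomial_eq_0)
    next
      case False
      then have "n - 3 * k = Suc (n + 2 - 3 * Suc k)" using k3 by simp
      then show ?thesis by (simp only: power_Suc mult_ac)
    qed
    have "of_nat ((n + 3 - 2 * Suc k) choose Suc k) * v ^ Suc k * u ^ (n + 3 - 3 * Suc k)
      = v ^ Suc k * (of_nat ((n - 2 * k) choose Suc k) * u ^ (n - 3 * k))
        + v * (of_nat ((n - 2 * k) choose k) * v ^ k * u ^ (n - 3 * k))"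
      unfolding pascal by (simp add: algebra_simps)
    then show ?thesis unfolding u by (simp add: algebra_simps)
  qed
  have "tri_sum u v (n + 3)
      = (\<Sum>k\<le>Suc ?K. of_nat ((n + 3 - 2 * k) choose k) * v ^ k * u ^ (n + 3 - 3 * k))"
    by (rule tri_sum_eq) simp
  also have "\<dots> = u ^ (n + 3) + (\<Sum>k\<le>?K.
        u * (of_nat ((n + 2 - 2 * Suc k) choose Suc k) * v ^ Suc k * u ^ (n + 2 - 3 * Suc k))
        + v * (of_nat ((n - 2 * k) choose k) * v ^ k * u ^ (n - 3 * k)))"
    unfolding sum.atMost_Suc_shift using step by (intro arg_cong2[of _ _ _ _ "(+)"] sum.cong) auto
  also have "\<dots> = u * (\<Sum>k\<le>Suc ?K.
        of_nat ((n + 2 - 2 * k) choose k) * v ^ k * u ^ (n + 2 - 3 * k)) + v * tri_sum u v n"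
    unfolding sum.atMost_Suc_shift tri_sum_def
    by (simp add: sum.distrib sum_distrib_left distrib_left power_add power3_eq_cube power2_eq_square)
  also have "(\<Sum>k\<le>Suc ?K. of_nat ((n + 2 - 2 * k) choose k) * v ^ k * u ^ (n + 2 - 3 * k))
      = tri_sum u v (n + 2)"
    by (rule tri_sum_eq[symmetric]) simp
  finally show ?thesis .
qed

text \<open>Multiplied by \<open>a - b\<close>, so that no division occurs.\<close>
lemma tri_sum_closed_form:
  fixes a b c :: "'a::comm_ring_1"
  assumes a: "a = 1 - b" and c: "c = b * (1 - b)"
  shows "(a - b) * (2 * (2 + c) * tri_sum (1 - c) (- (c ^ 2)) n)
    = (a - b) * (a ^ Suc n + b ^ Suc n) + 3 * (a ^ Suc n - b ^ Suc n)
      - 2 * (a - b) * (- c) ^ Suc n"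
proof (induction n rule: less_induct)
  case (less n)
  consider "n = 0" | "n = 1" | "n = 2" | "n = (n - 3) + 3"
    by linarith
  then show ?case
  proof cases
    case 1
    then show ?thesis by (simp add: tri_sum_def a c algebra_simps)
  next
    case 2
    then show ?thesis by (simp add: tri_sum_def a c algebra_simps)
  next
    case 3
    then show ?thesis
      by (simp add: tri_sum_def a c algebra_simps power2_eq_square power3_eq_cube)
  next
    case 4
    then obtain l where l: "n = l + 3" by blast
    \<comment> \<open>Since \<open>a + b = 1\<close> and \<open>a * b = c\<close>, the linear terms
      of \<open>(y - a) * (y - b) * (y + c)\<close> cancel, which leaves the characteristic
      polynomial of \<open>tri_sum_rec\<close>.\<close>
    have char: "y ^ (l + 4) = (1 - c) * y ^ (l + 3) - c ^ 2 * y ^ (l + 1)"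
      if "(y - a) * (y - b) * (y + c) = 0" for y
    proof -
      have "y ^ (l + 4) - ((1 - c) * y ^ (l + 3) - c ^ 2 * y ^ (l + 1))
          = y ^ (l + 1) * ((y - a) * (y - b) * (y + c))"
        by (simp add: a c algebra_simps power_add numeral_eq_Suc)
      then show ?thesis using that by simp
    qed
    have ca: "a ^ (l + 4) = (1 - c) * a ^ (l + 3) - c ^ 2 * a ^ (l + 1)"
      and cb: "b ^ (l + 4) = (1 - c) * b ^ (l + 3) - c ^ 2 * b ^ (l + 1)"
      and cc: "(- c) ^ (l + 4) = (1 - c) * (- c) ^ (l + 3) - c ^ 2 * (- c) ^ (l + 1)"
      by (rule char, simp)+
    let ?T = "tri_sum (1 - c) (- (c ^ 2))"
    let ?R = "\<lambda>n. (a - b) * (a ^ n + b ^ n) + 3 * (a ^ n - b ^ n) - 2 * (a - b) * (- c) ^ n"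
    have "(a - b) * (2 * (2 + c) * ?T n)
        = (1 - c) * ((a - b) * (2 * (2 + c) * ?T (l + 2)))
          - c ^ 2 * ((a - b) * (2 * (2 + c) * ?T l))"
      unfolding l tri_sum_rec by (simp add: algebra_simps)
    also have "\<dots> = (1 - c) * ?R (l + 3) - c ^ 2 * ?R (l + 1)"
      using less.IH[of "l + 2"] less.IH[of l] l by (simp add: numeral_eq_Suc)
    also have "\<dots> = ?R (l + 4)"
      unfolding ca cb cc by (simp only: algebra_simps)
    finally show ?thesis by (simp add: l numeral_eq_Suc)
  qed
qed

lemma to_fract_power: "to_fract (a ^ n) = to_fract a ^ n"
  by (induction n) auto

lemma to_fract_of_nat: "to_fract (of_nat n) = of_nat n"
  by (induction n) auto

lemma to_fract_numeral: "to_fract (numeral n) = numeral n"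
  by (metis of_nat_numeral to_fract_of_nat)

lemmas to_fract_hom = to_fract_power to_fract_of_nat to_fract_sum to_fract_numeral

lemma to_fract_tri_sum: "to_fract (tri_sum u v n) = tri_sum (to_fract u) (to_fract v) n"
  by (simp add: tri_sum_def to_fract_hom)

theorem theorem3:
  fixes p q f m e :: nat and \<alpha> \<beta> c x :: "int poly fract"
  assumes "prime p" and "odd p" and "f \<ge> 1" and "q = p ^ f"
    and "m \<in> {1, 2, 3}" and "e < q"
    and "\<beta> = to_fract [:0, 1:]" and "\<alpha> = 1 - \<beta>" and "c = \<beta> * (1 - \<beta>)"
    and "x = c ^ 2 / (1 - c) ^ 3"
  shows "poly_cong (int p)
    (2 * (2 + c) * (1 - c) ^ (m * q - 1 - e) *
       (\<Sum>k | real k < real (m * q - e) / 3. of_nat ((3 * k + e) choose k) * x ^ k))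
    ((\<alpha> ^ (m * q - e) + \<beta> ^ (m * q - e))
       + 3 * ((\<alpha> ^ (m * q - e) - \<beta> ^ (m * q - e)) / (\<alpha> - \<beta>))
       - 2 * (- c) ^ (m * q - e))"
proof -
  define n where "n = m * q - 1 - e"
  have "q \<le> m * q" and m3: "m \<le> 3" using assms(5) by auto
  then have n: "m * q - e = Suc n" and ne: "m * q = Suc n + e"
    using assms(6) unfolding n_def by linarith+
  define C :: "int poly" where "C = [:0, 1:] * (1 - [:0, 1:])"
  have c: "c = to_fract C" unfolding C_def assms(7,9) by (simp only: to_fract_mult to_fract_diff to_fract_1)
  \<comment> \<open>The strict bound \<open>3 * k < n + 1\<close> amounts to
    \<open>3 * k \<le> n\<close>.\<close>
  have index: "{k. real k < real (Suc n) / 3} = {..n div 3}" by auto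
  have "1 - C \<noteq> 0" by (simp add: C_def one_pCons)
  then have c1: "1 - c \<noteq> 0"
    unfolding c by (metis to_fract_1 to_fract_diff to_fract_eq_0_iff)
  have "to_fract (1 - [:0, 1:] - [:0, 1:] :: int poly) \<noteq> 0" by (simp add: one_pCons del: to_fract_diff)
  then have ab: "\<alpha> - \<beta> \<noteq> 0" by (simp only: assms(7,8) to_fract_diff to_fract_1 not_False_eq_True)
  \<comment> \<open>\<open>U\<close> is the left side with the denominators of \<open>x ^ k\<close>
    absorbed by \<open>(1 - c) ^ n\<close>. \<open>V\<close> has the replaced binomial coefficients
    and equals the right side exactly, so only \<open>U\<close> and \<open>V\<close> need a
    congruence.\<close>
  define U where "U = 2 * (2 + C) *
    (\<Sum>k\<le>n div 3. of_nat ((3 * k + e) choose k) * (C ^ 2) ^ k * (1 - C) ^ (n - 3 * k))"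
  define V where "V = 2 * (2 + C) * tri_sum (1 - C) (- (C ^ 2)) n"
  have "(1 - c) ^ n * (of_nat ((3 * k + e) choose k) * x ^ k)
      = of_nat ((3 * k + e) choose k) * (c ^ 2) ^ k * (1 - c) ^ (n - 3 * k)"
    if "k \<le> n div 3" for k
  proof -
    have "n = (n - 3 * k) + 3 * k" using that by linarith
    then have "(1 - c) ^ n = (1 - c) ^ (n - 3 * k) * ((1 - c) ^ 3) ^ k"
      by (metis power_add power_mult)
    then show ?thesis using c1 by (simp add: assms(10) power_divide)
  qed
  then have "(1 - c) ^ n * (\<Sum>k\<le>n div 3. of_nat ((3 * k + e) choose k) * x ^ k)
      = (\<Sum>k\<le>n div 3. of_nat ((3 * k + e) choose k) * (c ^ 2) ^ k * (1 - c) ^ (n - 3 * k))"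
    unfolding sum_distrib_left by (intro sum.cong) auto
  then have lhs: "2 * (2 + c) * (1 - c) ^ n *
      (\<Sum>k\<le>n div 3. of_nat ((3 * k + e) choose k) * x ^ k) = to_fract U"
    by (simp only: mult.assoc) (simp add: U_def c to_fract_hom mult.assoc)
  have "to_fract V = 2 * (2 + c) * tri_sum (1 - c) (- (c ^ 2)) n"
    by (simp add: V_def c to_fract_hom to_fract_tri_sum)
  then have "(\<alpha> - \<beta>) * to_fract V = (\<alpha> - \<beta>) * ((\<alpha> ^ Suc n + \<beta> ^ Suc n)
      + 3 * ((\<alpha> ^ Suc n - \<beta> ^ Suc n) / (\<alpha> - \<beta>)) - 2 * (- c) ^ Suc n)"
    using tri_sum_closed_form[OF assms(8,9), of n] ab
    by (simp only: distrib_left right_diff_distrib) (simp del: power_Suc)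
  \<comment> \<open>Cancelling \<open>\<alpha> - \<beta>\<close> in the field also shows that the
    quotient on the right yields a polynomial.\<close>
  then have rhs: "(\<alpha> ^ Suc n + \<beta> ^ Suc n)
      + 3 * ((\<alpha> ^ Suc n - \<beta> ^ Suc n) / (\<alpha> - \<beta>)) - 2 * (- c) ^ Suc n = to_fract V"
    using ab by (metis mult_left_cancel)
  have "[:int p:] dvd of_nat ((3 * k + e) choose k) * (C ^ 2) ^ k * (1 - C) ^ (n - 3 * k)
      - of_nat ((n - 2 * k) choose k) * (- (C ^ 2)) ^ k * (1 - C) ^ (n - 3 * k)"
    if k: "k \<le> n div 3" for k
  proof -
    have k3: "3 * k \<le> n" using k by linarith
    \<comment> \<open>The bound \<open>m \<le> 3\<close> enters here:
      \<open>3 * k \<le> n < m * q \<le> 3 * q\<close> gives the \<open>k < q\<close> that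
      \<open>choose_diff_cong\<close> requires.\<close>
    have "m * q \<le> 3 * q" using m3 by simp
    then have kq: "k < q" using k3 ne by linarith
    have "m * q - Suc (n - 3 * k) = 3 * k + e" "n - 3 * k + k = n - 2 * k"
      using k3 ne by auto
    then have "[int ((3 * k + e) choose k) = (- 1) ^ k * int ((n - 2 * k) choose k)] (mod int p)"
      using choose_diff_cong[OF assms(1), of f "m * q" "n - 3 * k" k] kq assms(4) ne by simp
    then have "int p dvd int ((3 * k + e) choose k) - (- 1) ^ k * int ((n - 2 * k) choose k)"
      by (simp add: cong_iff_dvd_diff)
    then have "[:int p:] dvd
        of_int (int ((3 * k + e) choose k) - (- 1) ^ k * int ((n - 2 * k) choose k))"
      by (simp only: of_int_poly const_poly_dvd_const_poly_iff of_int_eq_id id_apply)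
    then have "[:int p:] dvd
        of_int (int ((3 * k + e) choose k) - (- 1) ^ k * int ((n - 2 * k) choose k))
        * ((C ^ 2) ^ k * (1 - C) ^ (n - 3 * k))"
      by (rule dvd_mult2)
    \<comment> \<open>The sign \<open>(- 1) ^ k\<close> is absorbed into
      \<open>(- (C ^ 2)) ^ k\<close>.\<close>
    then show ?thesis
      by (simp only: of_int_diff of_int_mult of_int_power of_int_minus of_int_1 of_int_of_nat_eq
          left_diff_distrib right_diff_distrib power_minus[of "C ^ 2"] mult_ac)
  qed
  then have "[:int p:] dvd U - V"
    unfolding U_def V_def tri_sum_def right_diff_distrib[symmetric] sum_subtractf[symmetric]
    by (intro dvd_mult dvd_sum) auto
  then show ?thesis
    unfolding poly_cong_def n n_def[symmetric] index lhs rhs by blast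
qed

end
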